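(* Let $n\ge2$ and $1\le k\le n/2$. The total number of splits of the hypersimplex $\Delta(k,n)$ equals $$(k-1)\bigl(2^{n-1}-(n+1)\bigr)-\sum_{i=2}^{k-1}(k-i)\binom{n}{i}.$$
   Context: $\Delta(k,n)=\mathrm{conv}\{\sum_{i\in A}e_i:A\subseteq[n],\#A=k\}\subset\mathbb R^n$. A split of a polytope $P$ is a polytopal subdivision of $P$ without new vertices (all vertices are vertices of $P$) that has exactly two maximal cells. *)

theory Defs
  imports "HOL-Analysis.Analysis"
begin

text \<open>The coordinate index set is the finite type \<open>'n\<close>, so \<open>n = CARD('n)\<close>.\<close>

definition hypersimplex :: "nat \<Rightarrow> (real ^ 'n::finite) set" where
  "hypersimplex k = convex hull {(\<Sum>i\<in>A. axis i 1) | A :: 'n set. card A = k}"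

text \<open>The library relation \<open>face_of\<close> counts the empty set as a face, and the empty set is a
  polytope, so every nonempty complex contains the empty cell. This fixes one of the two
  usual conventions and so keeps the count of subdivisions unambiguous.\<close>

definition polytopal_complex :: "'a::euclidean_space set set \<Rightarrow> bool" where
  "polytopal_complex \<Sigma> \<longleftrightarrow>
     finite \<Sigma> \<and>
     (\<forall>C\<in>\<Sigma>. polytope C) \<and>
     (\<forall>C\<in>\<Sigma>. \<forall>F. F face_of C \<longrightarrow> F \<in> \<Sigma>) \<and>
     (\<forall>C\<in>\<Sigma>. \<forall>D\<in>\<Sigma>. (C \<inter> D) face_of C \<and> (C \<inter> D) face_of D)"

definition polytopal_subdivision :: "'a::euclidean_space set \<Rightarrow> 'a set set \<Rightarrow> bool" where
  "polytopal_subdivision P \<Sigma> \<longleftrightarrow> polytopal_complex \<Sigma> \<and> \<Union>\<Sigma> = P"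

definition without_new_vertices :: "'a::euclidean_space set \<Rightarrow> 'a set set \<Rightarrow> bool" where
  "without_new_vertices P \<Sigma> \<longleftrightarrow>
     (\<forall>C\<in>\<Sigma>. \<forall>v. v extreme_point_of C \<longrightarrow> v extreme_point_of P)"

definition maximal_cells :: "'a set set \<Rightarrow> 'a set set" where
  "maximal_cells \<Sigma> = {C \<in> \<Sigma>. \<forall>D\<in>\<Sigma>. C \<subseteq> D \<longrightarrow> D = C}"

definition is_split :: "'a::euclidean_space set \<Rightarrow> 'a set set \<Rightarrow> bool" where
  "is_split P \<Sigma> \<longleftrightarrow>
     polytopal_subdivision P \<Sigma> \<and> without_new_vertices P \<Sigma> \<and> card (maximal_cells \<Sigma>) = 2"

end

theory Submission
  imports Defs
begin

text \<open>
  The two maximal cells of a split of \<open>\<Delta>(k,n)\<close> are separated by a hyperplane \<open>a \<bullet> x = \<beta>\<close>, and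
  since the split has no new vertices this hyperplane meets no edge of \<open>\<Delta>(k,n)\<close> in an inner
  point. The edges join \<open>k\<close>-sets differing by one exchange. Hence some \<open>k\<close>-set \<open>Z\<close> lies on the
  hyperplane, and comparing the exchanges at \<open>Z\<close> shows that \<open>a\<close> takes only two values: on
  \<open>\<Delta>(k,n)\<close> the hyperplane is \<open>x(A) = m\<close> for a set \<open>A\<close> of coordinates and a natural number \<open>m\<close>.
  Conversely every such hyperplane cuts \<open>\<Delta>(k,n)\<close> into polytopes with 0/1 vertices, because a
  non-integral point of a piece has two fractional coordinates that can be varied in opposite
  directions. The cut is proper iff \<open>0 < m < k\<close>, \<open>m < |A|\<close> and \<open>k - m < n - |A|\<close>, and exactly
  the pairs \<open>(A, m)\<close> and \<open>(-A, k - m)\<close> give the same split, so the splits are counted by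
  half the number of these pairs.
\<close>

subsection \<open>Subdivisions with two maximal cells\<close>

text \<open>A face of \<open>C\<close> and a face of \<open>D\<close> meet inside the common face
  \<open>C \<inter> D\<close>. Their traces there are faces of \<open>C \<inter> D\<close>, hence so
  is their intersection, and transitivity makes it a face of both cells.\<close>

lemma polytopal_complex_faces_of_two:
  assumes "polytope C" "polytope D" "(C \<inter> D) face_of C" "(C \<inter> D) face_of D"
  shows "polytopal_complex ({F. F face_of C} \<union> {F. F face_of D})"
proof -
  have same: "(F \<inter> G) face_of F" if "F face_of X" "G face_of X" for F G X :: "'a set"
    by (meson face_of_Int face_of_imp_subset face_of_subset inf_le1 that)
  have mixed: "(F \<inter> G) face_of F"
    if F: "F face_of X" and G: "G face_of Y" and X: "(X \<inter> Y) face_of X" and Y: "(X \<inter> Y) face_of Y"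
    for F G X Y :: "'a set"
  proof -
    have FG: "F \<inter> G = (F \<inter> (X \<inter> Y)) \<inter> (G \<inter> (X \<inter> Y))"
      using F G face_of_imp_subset by blast
    have "(F \<inter> (X \<inter> Y)) face_of (X \<inter> Y)" "(G \<inter> (X \<inter> Y)) face_of (X \<inter> Y)"
      using F G X Y by (meson face_of_Int face_of_face inf_le2)+
    then have "(F \<inter> G) face_of (X \<inter> Y)"
      using FG face_of_Int by metis
    then have "(F \<inter> G) face_of X"
      using X face_of_trans by blast
    then show ?thesis
      using F face_of_face by blast
  qed
  have "(F \<inter> G) face_of F"
    if "F face_of C \<or> F face_of D" "G face_of C \<or> G face_of D" for F G
    using that same mixed[of F C G D] mixed[of F D G C] assms by (metis Int_commute)
  then have "(F \<inter> G) face_of F \<and> (F \<inter> G) face_of G"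
    if "F face_of C \<or> F face_of D" "G face_of C \<or> G face_of D" for F G
    using that by (metis Int_commute)
  then show ?thesis
    unfolding polytopal_complex_def
    using assms(1,2)
    by (auto simp: finite_polytope_faces intro: face_of_polytope_polytope face_of_trans)
qed

lemma maximal_cells_faces_of_two:
  assumes "convex C" "convex D" "\<not> C \<subseteq> D" "\<not> D \<subseteq> C"
  shows "maximal_cells ({F. F face_of C} \<union> {F. F face_of D}) = {C, D}"
proof -
  have "C face_of C" "D face_of D"
    using assms face_of_refl by auto
  moreover have "F \<subseteq> C \<or> F \<subseteq> D" if "F \<in> {F. F face_of C} \<union> {F. F face_of D}" for F
    using that face_of_imp_subset by blast
  ultimately have "F \<in> maximal_cells ({F. F face_of C} \<union> {F. F face_of D}) \<longleftrightarrow> F = C \<or> F = D" for F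
    unfolding maximal_cells_def mem_Collect_eq using assms(3,4)
    by (metis (no_types, lifting) UnI1 UnI2 mem_Collect_eq order_trans subset_antisym)
  then show ?thesis by blast
qed

lemma is_split_faces_of_two:
  assumes "polytope C" "polytope D" "(C \<inter> D) face_of C" "(C \<inter> D) face_of D"
    and "\<not> C \<subseteq> D" "\<not> D \<subseteq> C" "C \<union> D = P"
    and "\<And>v. v extreme_point_of C \<Longrightarrow> v extreme_point_of P"
    and "\<And>v. v extreme_point_of D \<Longrightarrow> v extreme_point_of P"
  shows "is_split P ({F. F face_of C} \<union> {F. F face_of D})"
proof -
  have conv: "convex C" "convex D"
    using assms(1,2) polytope_imp_convex by auto
  have "\<Union>({F. F face_of C} \<union> {F. F face_of D}) = P"
    using conv assms(7) face_of_refl face_of_imp_subset by blast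
  moreover have "card (maximal_cells ({F. F face_of C} \<union> {F. F face_of D})) = 2"
    using maximal_cells_faces_of_two[OF conv assms(5,6)] assms(5) by auto
  moreover have "without_new_vertices P ({F. F face_of C} \<union> {F. F face_of D})"
    unfolding without_new_vertices_def using assms(8,9) extreme_point_of_face by blast
  ultimately show ?thesis
    unfolding is_split_def polytopal_subdivision_def
    using polytopal_complex_faces_of_two assms(1-4) by blast
qed

text \<open>A split is determined by its two maximal cells: by finiteness every cell lies in one of
  them, and a cell \<open>X\<close> inside \<open>C\<close> equals \<open>C \<inter> X\<close>,
  which is a face of \<open>C\<close>.\<close>

lemma is_split_obtain_cells:
  assumes "is_split P \<Sigma>"
  obtains C D where "polytope C" "polytope D" "(C \<inter> D) face_of C" "(C \<inter> D) face_of D"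
    "\<not> C \<subseteq> D" "\<not> D \<subseteq> C" "C \<union> D = P"
    "\<forall>v. v extreme_point_of C \<longrightarrow> v extreme_point_of P"
    "\<forall>v. v extreme_point_of D \<longrightarrow> v extreme_point_of P"
    "\<Sigma> = {F. F face_of C} \<union> {F. F face_of D}"
proof -
  have complex: "polytopal_complex \<Sigma>" and un: "\<Union>\<Sigma> = P" and new: "without_new_vertices P \<Sigma>"
    and "card (maximal_cells \<Sigma>) = 2"
    using assms by (auto simp: is_split_def polytopal_subdivision_def)
  then obtain C D where CD: "maximal_cells \<Sigma> = {C, D}" "C \<noteq> D"
    by (meson card_2_iff)
  then have "C \<in> maximal_cells \<Sigma>" "D \<in> maximal_cells \<Sigma>"
    by auto
  then have mem: "C \<in> \<Sigma>" "D \<in> \<Sigma>" and nsub: "\<not> C \<subseteq> D" "\<not> D \<subseteq> C"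
    using CD(2) by (auto simp: maximal_cells_def)
  have fin: "finite \<Sigma>"
    using complex by (simp add: polytopal_complex_def)
  have poly: "polytope X" if "X \<in> \<Sigma>" for X
    using complex that by (simp add: polytopal_complex_def)
  have face: "F \<in> \<Sigma>" if "F face_of X" "X \<in> \<Sigma>" for F X
    using complex that unfolding polytopal_complex_def by blast
  have int: "(X \<inter> Y) face_of X" "(X \<inter> Y) face_of Y" if "X \<in> \<Sigma>" "Y \<in> \<Sigma>" for X Y
    using complex that unfolding polytopal_complex_def by auto
  have below: "X \<subseteq> C \<or> X \<subseteq> D" if "X \<in> \<Sigma>" for X
  proof -
    obtain M where M: "M \<in> \<Sigma>" "X \<subseteq> M" "\<And>Y. Y \<in> \<Sigma> \<Longrightarrow> M \<subseteq> Y \<Longrightarrow> Y = M"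
      using finite_has_maximal2[OF fin \<open>X \<in> \<Sigma>\<close>] by metis
    then have "M \<in> maximal_cells \<Sigma>"
      by (auto simp: maximal_cells_def)
    with CD M(2) show ?thesis by auto
  qed
  have eq: "\<Sigma> = {F. F face_of C} \<union> {F. F face_of D}"
  proof
    show "\<Sigma> \<subseteq> {F. F face_of C} \<union> {F. F face_of D}"
    proof
      fix X assume "X \<in> \<Sigma>"
      with below[OF this] int(1)[OF \<open>C \<in> \<Sigma>\<close> this] int(1)[OF \<open>D \<in> \<Sigma>\<close> this]
      show "X \<in> {F. F face_of C} \<union> {F. F face_of D}"
        by (auto simp: Int_absorb1)
    qed
  qed (use face mem in blast)
  have "C \<union> D = P"
    using un below mem by blast
  then show thesis
    using that[of C D] poly[OF mem(1)] poly[OF mem(2)] int[OF mem] nsub new mem eq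
    unfolding without_new_vertices_def by metis
qed

section \<open>Separating the two maximal cells by a hyperplane\<close>

lemma rel_interior_Int_face_empty:
  fixes C D :: "'a::euclidean_space set"
  assumes "(C \<inter> D) face_of C" "\<not> C \<subseteq> D"
  shows "rel_interior C \<inter> D = {}"
proof -
  have "C \<inter> D \<inter> rel_interior C = {}"
    using face_of_disjoint_rel_interior[OF assms(1)] assms(2) by auto
  then show ?thesis using rel_interior_subset[of C] by auto
qed

text \<open>The hypersimplex is not full-dimensional, so an arbitrary separating normal might be
  constant on both sets. Choosing the normal in the span of the differences \<open>y - x\<close>
  excludes this.\<close>

lemma proper_separation:
  fixes C D :: "'a::euclidean_space set"
  assumes "convex C" "convex D" "C \<noteq> {}" "D \<noteq> {}" "rel_interior C \<inter> rel_interior D = {}"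
  obtains a where "\<And>x y. x \<in> C \<Longrightarrow> y \<in> D \<Longrightarrow> a \<bullet> x \<le> a \<bullet> y"
    "\<exists>x\<in>C. \<exists>y\<in>D. a \<bullet> x < a \<bullet> y"
proof -
  define S where "S = {y - x | x y. x \<in> rel_interior C \<and> y \<in> rel_interior D}"
  have conv: "convex (rel_interior C)" "convex (rel_interior D)"
    using assms convex_rel_interior by auto
  have ne: "rel_interior C \<noteq> {}" "rel_interior D \<noteq> {}"
    using assms rel_interior_eq_empty by auto
  have "S = (\<Union>y\<in>rel_interior D. \<Union>x\<in>rel_interior C. {y - x})"
    unfolding S_def by blast
  then have "convex S"
    using convex_differences[OF conv(2,1)] by simp
  moreover have "S \<noteq> {}" "0 \<notin> S"
    using ne assms(5) unfolding S_def by auto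
  ultimately obtain a where a: "a \<in> span S" "a \<noteq> 0" "\<And>x. x \<in> S \<Longrightarrow> 0 \<le> a \<bullet> x"
    using separating_hyperplane_set_0_inspan by metis
  have le: "a \<bullet> x \<le> a \<bullet> y" if "x \<in> C" "y \<in> D" for x y
  proof -
    have int: "a \<bullet> u \<le> a \<bullet> v" if "u \<in> rel_interior C" "v \<in> rel_interior D" for u v
      using a(3)[of "v - u"] that unfolding S_def by (auto simp: inner_diff_right)
    have "C \<subseteq> closure (rel_interior C)" "D \<subseteq> closure (rel_interior D)"
      using assms convex_closure_rel_interior closure_subset by metis+
    moreover have "closure (rel_interior C) \<subseteq> {u. a \<bullet> u \<le> a \<bullet> v}" if "v \<in> rel_interior D" for v
      by (rule closure_minimal) (auto simp: closed_halfspace_le int that)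
    moreover from this \<open>C \<subseteq> _\<close> have "closure (rel_interior D) \<subseteq> {v. a \<bullet> v \<ge> a \<bullet> u}" if "u \<in> C" for u
      using that by (intro closure_minimal) (auto simp: closed_halfspace_ge)
    ultimately show ?thesis using that by blast
  qed
  \<comment> \<open>A normal orthogonal to all differences would be orthogonal to their span, hence
    to itself.\<close>
  have "\<exists>s\<in>S. a \<bullet> s \<noteq> 0"
  proof (rule ccontr)
    assume "\<not> ?thesis"
    then have "a \<bullet> a = 0"
      using a(1) by (metis orthogonal_def orthogonal_to_span)
    with a(2) show False by simp
  qed
  then obtain x y where "x \<in> C" "y \<in> D" "a \<bullet> (y - x) \<noteq> 0"
    unfolding S_def using rel_interior_subset by blast
  then have "a \<bullet> x < a \<bullet> y"
    using le[of x y] by (simp add: inner_diff_right)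
  with le \<open>x \<in> C\<close> \<open>y \<in> D\<close> show thesis
    using that by blast
qed

text \<open>The open segment from \<open>c\<close> to a point \<open>x\<close> of the halfspace
  stays in \<open>P\<close> and strictly below \<beta>, so it misses \<open>D\<close> and lies in
  \<open>C\<close>. Closedness of \<open>C\<close> then adds the endpoint \<open>x\<close>.\<close>

lemma halfspace_Int_subset_cell:
  fixes C D P :: "'a::euclidean_space set"
  assumes "convex P" "closed C" "C \<union> D = P"
    and D: "\<And>y. y \<in> D \<Longrightarrow> \<beta> \<le> a \<bullet> y" and c: "c \<in> C" "a \<bullet> c < \<beta>"
  shows "P \<inter> {x. a \<bullet> x \<le> \<beta>} \<subseteq> C"
proof
  fix x assume x: "x \<in> P \<inter> {x. a \<bullet> x \<le> \<beta>}"
  have "c \<noteq> x \<Longrightarrow> open_segment c x \<subseteq> C"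
  proof
    fix z assume z: "z \<in> open_segment c x"
    then obtain u where u: "0 < u" "u < 1" "z = (1 - u) *\<^sub>R c + u *\<^sub>R x"
      by (auto simp: in_segment)
    have "z \<in> P"
      using z assms(1,3) c(1) x by (metis IntD1 UnI1 convex_contains_open_segment subsetD)
    moreover have "a \<bullet> z < \<beta>"
    proof -
      have "(1 - u) * (a \<bullet> c) < (1 - u) * \<beta>" "u * (a \<bullet> x) \<le> u * \<beta>"
        using u c x by auto
      then show ?thesis using u(3) by (simp add: inner_add_right left_diff_distrib)
    qed
    ultimately show "z \<in> C" using D assms(3) by force
  qed
  then show "x \<in> C"
    using assms(2) c(1) closure_minimal[of "open_segment c x" C]
    by (cases "c = x") auto
qed

text \<open>The relative interiors of the cells are disjoint, so some hyperplane separates the cells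
  properly; as the cells cover a convex set, each is all that lies on its side.\<close>

lemma two_cells_halfspaces:
  fixes C D P :: "'a::euclidean_space set"
  assumes "polytope C" "polytope D" "(C \<inter> D) face_of C" "(C \<inter> D) face_of D"
    and ns: "\<not> C \<subseteq> D" "\<not> D \<subseteq> C" and un: "C \<union> D = P" and P: "convex P"
  obtains a \<beta> where "C = P \<inter> {x. a \<bullet> x \<le> \<beta>}" "D = P \<inter> {x. a \<bullet> x \<ge> \<beta>}"
proof -
  have conv: "convex C" "convex D" and cl: "closed C" "closed D"
    using assms(1,2) polytope_imp_convex polytope_imp_closed by auto
  have ne: "C \<noteq> {}" "D \<noteq> {}" using ns by auto
  \<comment> \<open>Two nonempty closed sets covering a connected set meet; the value of
    \<open>a\<close> at a common point is the only possible offset \<beta>.\<close>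
  have "connected P" using P convex_connected by auto
  then have "C \<inter> D \<noteq> {}"
    unfolding connected_closed using cl un ne by blast
  then obtain e where e: "e \<in> C" "e \<in> D" by blast
  have "rel_interior C \<inter> rel_interior D = {}"
    using rel_interior_Int_face_empty[OF assms(3) ns(1)] rel_interior_subset[of D] by blast
  then obtain a where a: "\<And>x y. x \<in> C \<Longrightarrow> y \<in> D \<Longrightarrow> a \<bullet> x \<le> a \<bullet> y"
    and proper: "\<exists>x\<in>C. \<exists>y\<in>D. a \<bullet> x < a \<bullet> y"
    using proper_separation[OF conv ne] by metis
  define \<beta> where "\<beta> = a \<bullet> e"
  have C: "a \<bullet> x \<le> \<beta>" if "x \<in> C" for x
    using a[OF that e(2)] by (simp add: \<beta>_def)
  have D: "\<beta> \<le> a \<bullet> y" if "y \<in> D" for y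
    using a[OF e(1) that] by (simp add: \<beta>_def)
  have 1: "P \<inter> {x. a \<bullet> x \<le> \<beta>} \<subseteq> C" if "c \<in> C" "a \<bullet> c < \<beta>" for c
    using halfspace_Int_subset_cell[OF P cl(1) un D that] .
  have 2: "P \<inter> {x. a \<bullet> x \<ge> \<beta>} \<subseteq> D" if "d \<in> D" "a \<bullet> d > \<beta>" for d
    using halfspace_Int_subset_cell[of P D C "-\<beta>" "-a" d] P cl(2) un C that by (auto simp: Un_commute)
  \<comment> \<open>If \<open>C\<close> lay in the hyperplane, proper separation would give a point
    of \<open>D\<close> strictly above it. Then \<open>D\<close> would fill the closed upper side of
    \<open>P\<close> and contain \<open>C\<close>.\<close>
  have "\<exists>c\<in>C. a \<bullet> c < \<beta>"
  proof (rule ccontr)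
    assume "\<not> ?thesis"
    then have eq: "a \<bullet> c = \<beta>" if "c \<in> C" for c
      using C that by force
    then obtain d where "d \<in> D" "a \<bullet> d > \<beta>"
      using proper by auto
    from 2[OF this] show False
      using eq un ns by auto
  qed
  moreover have "\<exists>d\<in>D. a \<bullet> d > \<beta>"
  proof (rule ccontr)
    assume "\<not> ?thesis"
    then have eq: "a \<bullet> d = \<beta>" if "d \<in> D" for d
      using D that by force
    then obtain c where "c \<in> C" "a \<bullet> c < \<beta>"
      using proper by auto
    from 1[OF this] show False
      using eq un ns by auto
  qed
  ultimately have "C = P \<inter> {x. a \<bullet> x \<le> \<beta>}" "D = P \<inter> {x. a \<bullet> x \<ge> \<beta>}"
    using 1 2 C D un by auto
  then show thesis using that by blast
qed

subsection \<open>Cutting the hypersimplex\<close>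

definition indvec :: "'n::finite set \<Rightarrow> real ^ 'n" where
  "indvec A = (\<Sum>i\<in>A. axis i 1)"

lemma indvec_nth [simp]: "indvec A $ i = (if i \<in> A then 1 else 0)"
  by (simp add: indvec_def axis_def if_distrib[of "\<lambda>f. f _"] cong: if_cong)

lemma inner_indvec: "indvec A \<bullet> x = (\<Sum>i\<in>A. x $ i)"
  by (simp add: inner_vec_def if_distrib[of "\<lambda>c. c * _"] sum.If_cases cong: if_cong)

lemma inner_indvec_indvec [simp]: "indvec A \<bullet> indvec S = real (card (A \<inter> S))"
  by (simp add: inner_indvec sum.If_cases)

lemma inner_indvec_Compl: "indvec (- A) \<bullet> x = indvec UNIV \<bullet> x - indvec A \<bullet> x"
  by (simp add: inner_indvec Compl_eq_Diff_UNIV sum_diff)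

text \<open>Raising one fractional coordinate and lowering another keeps the total \<open>k\<close>.
  At an extreme point this must violate the constraint on \<open>A\<close>, so any two fractional
  coordinates lie on different sides of \<open>A\<close> and that constraint is tight. Integrality
  of the tight sum then rules out fractional coordinates altogether.\<close>

lemma extreme_point_box_slice:
  fixes v :: "real ^ 'n::finite" and m k :: nat
  assumes v: "v extreme_point_of (cbox 0 1 \<inter> {x. indvec UNIV \<bullet> x = real k} \<inter> {x. indvec A \<bullet> x \<le> real m})"
    (is "v extreme_point_of ?Q")
  obtains S where "card S = k" "v = indvec S"
proof -
  have vQ: "v \<in> ?Q" and ext: "\<And>a b. a \<in> ?Q \<Longrightarrow> b \<in> ?Q \<Longrightarrow> v \<notin> open_segment a b"
    using v by (auto simp: extreme_point_of_def)
  have box: "0 \<le> v $ l" "v $ l \<le> 1" for l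
    using vQ by (auto simp: mem_box_cart)
  have sumk: "(\<Sum>l\<in>UNIV. v $ l) = real k" and leA: "indvec A \<bullet> v \<le> real m"
    using vQ by (auto simp: inner_indvec)
  define frac where "frac l \<longleftrightarrow> 0 < v $ l \<and> v $ l < 1" for l
  have swap: "(i \<in> A) \<noteq> (j \<in> A) \<and> indvec A \<bullet> v = m" if "frac i" "frac j" "i \<noteq> j" for i j
  proof (rule ccontr)
    assume neg: "\<not> ?thesis"
    \<comment> \<open>The slack available for the constraint on \<open>A\<close>: the move leaves
      that sum unchanged if \<open>i\<close> and \<open>j\<close> are on the same side of
      \<open>A\<close>, so any positive bound serves there.\<close>
    define s where "s = (if (i \<in> A) = (j \<in> A) then 1 else m - indvec A \<bullet> v)"
    define e where "e = Min {v $ i, 1 - v $ i, v $ j, 1 - v $ j, s}"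
    have "s > 0" using neg leA by (auto simp: s_def)
    then have "e > 0" using that by (auto simp: e_def frac_def)
    have e: "e \<le> v $ i" "e \<le> 1 - v $ i" "e \<le> v $ j" "e \<le> 1 - v $ j" "e \<le> s"
      by (auto simp: e_def)
    define d :: "real ^ 'n" where "d = e *\<^sub>R (axis i 1 - axis j 1)"
    have d_nth: "d $ l = (if l = i then e else if l = j then - e else 0)" for l
      using that(3) by (auto simp: d_def axis_def)
    have sum_d: "indvec B \<bullet> d = (if i \<in> B then e else 0) - (if j \<in> B then e else 0)" for B
      by (auto simp: d_def inner_diff_right inner_axis)
    have "v + d \<in> ?Q" "v - d \<in> ?Q"
      using vQ e sum_d[of A] that(3) \<open>e > 0\<close>
      by (auto simp: mem_box_cart d_nth inner_add_right inner_diff_right sum_d s_def split: if_splits)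
    moreover have "v \<in> open_segment (v + d) (v - d)"
    proof -
      have "d \<noteq> 0" using d_nth[of i] \<open>e > 0\<close> by auto
      then have "v + d \<noteq> v - d"
        by (simp add: eq_neg_iff_add_eq_0 scaleR_2[symmetric])
      moreover have "v = midpoint (v + d) (v - d)"
        by (simp add: midpoint_def scaleR_2[symmetric])
      ultimately show ?thesis by (metis midpoint_in_open_segment)
    qed
    ultimately show False using ext by blast
  qed
  \<comment> \<open>A single fractional summand cannot occur in an integral sum.\<close>
  have other: "\<exists>j\<in>B. j \<noteq> i \<and> frac j" if "frac i" "i \<in> B" "(\<Sum>l\<in>B. v $ l) \<in> \<int>" for i B
  proof (rule ccontr)
    assume neg: "\<not> ?thesis"
    have "v $ l \<in> \<int>" if "l \<in> B - {i}" for l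
    proof -
      have "v $ l = 0 \<or> v $ l = 1"
        using neg that box[of l] by (force simp: frac_def)
      then show ?thesis by auto
    qed
    then have "(\<Sum>l\<in>B - {i}. v $ l) \<in> \<int>" by auto
    moreover have "v $ i = (\<Sum>l\<in>B. v $ l) - (\<Sum>l\<in>B - {i}. v $ l)"
      using that(2) by (simp add: sum.remove)
    ultimately have "v $ i \<in> \<int>" using that(3) by simp
    with that(1) show False
      unfolding frac_def by (auto elim!: Ints_cases)
  qed
  \<comment> \<open>Of two fractional coordinates exactly one, \<open>p\<close>, is in
    \<open>A\<close>. The sum over \<open>A\<close> is then the integer \<open>m\<close>, which
    forces a second fractional coordinate in \<open>A\<close>, against \<open>swap\<close>.\<close>
  have "\<not> frac i" for i
  proof
    assume i: "frac i"
    then obtain j where j: "j \<noteq> i" "frac j"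
      using other[of i UNIV] sumk by auto
    obtain p where p: "frac p" "p \<in> A"
      using swap[OF i j(2)] i j by metis
    then obtain q where "q \<in> A" "q \<noteq> p" "frac q"
      using other[OF p] swap[OF i j(2)] j(1) by (auto simp: inner_indvec)
    then show False using swap p by blast
  qed
  then have 01: "v $ l = 0 \<or> v $ l = 1" for l
    using box[of l] by (metis frac_def order_less_le)
  have "v = indvec {l. v $ l = 1}"
    using 01 by (auto simp: vec_eq_iff)
  moreover from this have "card {l. v $ l = 1} = k"
    using sumk by (metis inner_indvec inner_indvec_indvec Int_UNIV_left of_nat_eq_iff)
  ultimately show thesis using that by blast
qed

lemma box_slice_eq_convex_hull:
  "cbox 0 1 \<inter> {x. indvec UNIV \<bullet> x = real k} \<inter> {x. indvec A \<bullet> x \<le> real m}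
    = convex hull (indvec ` {S. card S = k \<and> card (A \<inter> S) \<le> m})" (is "?Q = convex hull ?V")
proof
  have conv: "convex ?Q"
    by (intro convex_Int convex_box convex_hyperplane convex_halfspace_le)
  have "compact ?Q"
    by (intro compact_Int_closed compact_cbox closed_hyperplane closed_halfspace_le)
  then have "?Q = convex hull {x. x extreme_point_of ?Q}"
    using conv Krein_Milman_Minkowski by blast
  also have "\<dots> \<subseteq> convex hull ?V"
  proof (rule hull_mono, safe)
    fix v assume v: "v extreme_point_of ?Q"
    then obtain S where S: "card S = k" "v = indvec S"
      by (rule extreme_point_box_slice)
    moreover have "v \<in> ?Q" using v by (simp add: extreme_point_of_def)
    ultimately show "v \<in> ?V" by auto
  qed
  finally show "?Q \<subseteq> convex hull ?V" .
  show "convex hull ?V \<subseteq> ?Q"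
    using conv by (intro hull_minimal) (auto simp: mem_box_cart)
qed

lemma hypersimplex_eq_convex_hull: "hypersimplex k = convex hull (indvec ` {S. card S = k})"
  unfolding hypersimplex_def indvec_def by (simp add: image_Collect)

text \<open>With \<open>A\<close> empty and \<open>m = 0\<close> the additional halfspace is the
  whole space.\<close>

lemma hypersimplex_eq_box_slice:
  "hypersimplex k = cbox 0 1 \<inter> {x. indvec UNIV \<bullet> x = real k}"
  using box_slice_eq_convex_hull[of k "{}" 0, symmetric]
  by (simp add: hypersimplex_eq_convex_hull inner_indvec)

lemma indvec_in_hypersimplex: "card S = k \<Longrightarrow> indvec S \<in> hypersimplex k"
  by (simp add: hypersimplex_eq_box_slice mem_box_cart)

lemma convex_hypersimplex: "convex (hypersimplex k)"
  by (simp add: hypersimplex_eq_convex_hull)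

text \<open>Each coordinate of \<open>indvec S\<close> is an endpoint of [0,1], so a segment in the
  unit cube with \<open>indvec S\<close> in its interior is constant in every coordinate.\<close>

lemma extreme_point_of_hypersimplex:
  "v extreme_point_of (hypersimplex k) \<longleftrightarrow> (\<exists>S. card S = k \<and> v = indvec S)"
proof safe
  assume "v extreme_point_of (hypersimplex k)"
  then have "v \<in> indvec ` {S. card S = k}"
    unfolding hypersimplex_eq_convex_hull by (rule extreme_point_of_convex_hull)
  then show "\<exists>S. card S = k \<and> v = indvec S" by auto
next
  fix S :: "'a set"
  have "indvec S \<notin> open_segment a b" if a: "a \<in> hypersimplex (card S)" and b: "b \<in> hypersimplex (card S)" for a b
  proof
    assume "indvec S \<in> open_segment a b"
    then obtain u where u: "0 < u" "u < 1" "indvec S = (1 - u) *\<^sub>R a + u *\<^sub>R b" and "a \<noteq> b"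
      by (auto simp: in_segment)
    have "a $ i = b $ i" for i
    proof -
      have ab: "0 \<le> a $ i" "a $ i \<le> 1" "0 \<le> b $ i" "b $ i \<le> 1"
        using a b by (auto simp: hypersimplex_eq_box_slice mem_box_cart)
      have eq: "(if i \<in> S then 1 else 0) = (1 - u) * a $ i + u * b $ i"
        using arg_cong[OF u(3), of "\<lambda>x. x $ i"] by simp
      show ?thesis
      proof (cases "i \<in> S")
        case True
        then have "(1 - u) * (1 - a $ i) + u * (1 - b $ i) = 0"
          using eq by (simp add: algebra_simps)
        moreover have "0 \<le> (1 - u) * (1 - a $ i)" "0 \<le> u * (1 - b $ i)"
          using u ab by auto
        ultimately have "(1 - u) * (1 - a $ i) = 0" "u * (1 - b $ i) = 0"
          by linarith+
        then show ?thesis using u by auto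
      next
        case False
        then have "(1 - u) * a $ i + u * b $ i = 0"
          using eq by simp
        moreover have "0 \<le> (1 - u) * a $ i" "0 \<le> u * b $ i"
          using u ab by auto
        ultimately have "(1 - u) * a $ i = 0" "u * b $ i = 0"
          by linarith+
        then show ?thesis using u by auto
      qed
    qed
    then show False using \<open>a \<noteq> b\<close> by (simp add: vec_eq_iff)
  qed
  then show "indvec S extreme_point_of (hypersimplex (card S))"
    unfolding extreme_point_of_def using indvec_in_hypersimplex by blast
qed

section \<open>Cells and splits given by a coordinate set and a level\<close>

definition cut_cell :: "nat \<Rightarrow> 'n::finite set \<Rightarrow> nat \<Rightarrow> (real ^ 'n) set" where
  "cut_cell k A m = hypersimplex k \<inter> {x. indvec A \<bullet> x \<le> real m}"

text \<open>The coordinates sum to \<open>k\<close>, so for \<open>m \<le> k\<close> the inequality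
  x(-A) <= k - m is x(A) >= m. Writing the upper cell in this way makes both cells instances of
  \<open>cut_cell\<close> and the symmetry under complement immediate.\<close>

definition cut_split :: "nat \<Rightarrow> 'n::finite set \<Rightarrow> nat \<Rightarrow> (real ^ 'n) set set" where
  "cut_split k A m = {F. F face_of cut_cell k A m} \<union> {F. F face_of cut_cell k (- A) (k - m)}"

definition cut_pair :: "nat \<Rightarrow> 'n::finite set \<Rightarrow> nat \<Rightarrow> bool" where
  "cut_pair k A m \<longleftrightarrow> 0 < m \<and> m < k \<and> m < card A \<and> k - m < card (- A)"

lemma cut_pair_Compl: "cut_pair k A m \<Longrightarrow> cut_pair k (- A) (k - m)"
  by (auto simp: cut_pair_def)

lemma cut_split_Compl: "m \<le> k \<Longrightarrow> cut_split k (- A) (k - m) = cut_split k A m"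
  by (simp add: cut_split_def Un_commute)

lemma cut_cell_eq_convex_hull:
  "cut_cell k A m = convex hull (indvec ` {S. card S = k \<and> card (A \<inter> S) \<le> m})"
  unfolding cut_cell_def hypersimplex_eq_box_slice by (rule box_slice_eq_convex_hull)

lemma polytope_cut_cell: "polytope (cut_cell k A m)"
  unfolding cut_cell_eq_convex_hull by (simp add: polytope_convex_hull)

lemma cut_cell_Compl:
  assumes "m \<le> k"
  shows "cut_cell k (- A) (k - m) = hypersimplex k \<inter> {x. indvec A \<bullet> x \<ge> real m}"
  using assms by (auto simp: cut_cell_def hypersimplex_eq_box_slice inner_indvec_Compl)

lemma indvec_in_cut_cell: "card S = k \<Longrightarrow> indvec S \<in> cut_cell k A m \<longleftrightarrow> card (A \<inter> S) \<le> m"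
  by (simp add: cut_cell_def indvec_in_hypersimplex)

lemma indvec_in_cut_cell_Compl:
  "card S = k \<Longrightarrow> m \<le> k \<Longrightarrow> indvec S \<in> cut_cell k (- A) (k - m) \<longleftrightarrow> m \<le> card (A \<inter> S)"
  by (simp add: cut_cell_Compl indvec_in_hypersimplex)

lemma extreme_point_of_cut_cell:
  assumes "v extreme_point_of (cut_cell k A m)"
  shows "v extreme_point_of (hypersimplex k)"
  using extreme_point_of_convex_hull[of v] assms
  unfolding cut_cell_eq_convex_hull extreme_point_of_hypersimplex by blast

lemma obtain_set_card_Int:
  fixes A :: "'n::finite set"
  assumes "a \<le> card A" "b \<le> card (- A)"
  obtains S where "card S = a + b" "card (A \<inter> S) = a"
proof -
  obtain S1 where S1: "S1 \<subseteq> A" "card S1 = a"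
    using obtain_subset_with_card_n[OF assms(1)] by metis
  obtain S2 where S2: "S2 \<subseteq> - A" "card S2 = b"
    using obtain_subset_with_card_n[OF assms(2)] by metis
  have "card (S1 \<union> S2) = a + b"
    using S1 S2 by (subst card_Un_disjoint) auto
  moreover have "A \<inter> (S1 \<union> S2) = S1" using S1 S2 by blast
  ultimately show thesis using that S1 by metis
qed

text \<open>The four inequalities are what it takes to choose \<open>k\<close>-sets with
  \<open>m - 1\<close> and with \<open>m + 1\<close> elements in \<open>A\<close>. In terms of
  vertices, the hyperplane has some strictly on each side.\<close>

lemma cut_pair_iff:
  "cut_pair k A m \<longleftrightarrow>
    (\<exists>S. card S = k \<and> card (A \<inter> S) < m) \<and> (\<exists>T. card T = k \<and> m < card (A \<inter> T))"
proof safe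
  assume A: "cut_pair k A m"
  show "\<exists>S. card S = k \<and> card (A \<inter> S) < m"
    by (rule obtain_set_card_Int[of "m - 1" A "k - m + 1"]) (use A in \<open>auto simp: cut_pair_def\<close>)
  show "\<exists>T. card T = k \<and> m < card (A \<inter> T)"
    by (rule obtain_set_card_Int[of "m + 1" A "k - m - 1"]) (use A in \<open>auto simp: cut_pair_def\<close>)
next
  fix S T :: "'a set"
  assume S: "card (A \<inter> S) < m" and T: "card T = card S" "m < card (A \<inter> T)"
  have "card (A \<inter> S) + card (- A \<inter> S) = card S"
    by (subst card_Un_disjoint[symmetric]) (auto intro: arg_cong[of _ _ card])
  moreover have "card (- A \<inter> S) \<le> card (- A)" "card (A \<inter> T) \<le> card A" "card (A \<inter> T) \<le> card T"
    by (auto intro: card_mono)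
  ultimately show "cut_pair (card S) A m"
    using S T by (auto simp: cut_pair_def)
qed

lemma cut_cell_not_subset:
  assumes "cut_pair k A m"
  shows "\<not> cut_cell k A m \<subseteq> cut_cell k (- A) (k - m)"
proof -
  obtain S where "card S = k" "card (A \<inter> S) < m"
    using assms cut_pair_iff by blast
  moreover have "m \<le> k" using assms by (simp add: cut_pair_def)
  ultimately show ?thesis
    using indvec_in_cut_cell[of S k A m] indvec_in_cut_cell_Compl[of S k m A] by auto
qed

lemma is_split_cut_split:
  assumes "cut_pair k A m"
  shows "is_split (hypersimplex k) (cut_split k A m)"
  unfolding cut_split_def
proof (rule is_split_faces_of_two)
  have mk: "m \<le> k" using assms by (simp add: cut_pair_def)
  \<comment> \<open>The common wall is where the defining inequality of either cell is tight, hence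
    an exposed face of both.\<close>
  have 1: "cut_cell k A m \<inter> cut_cell k (- A) (k - m) = cut_cell k A m \<inter> {x. indvec A \<bullet> x = real m}"
    and 2: "cut_cell k A m \<inter> cut_cell k (- A) (k - m) = cut_cell k (- A) (k - m) \<inter> {x. indvec A \<bullet> x = real m}"
    unfolding cut_cell_Compl[OF mk] by (auto simp: cut_cell_def)
  show "(cut_cell k A m \<inter> cut_cell k (- A) (k - m)) face_of cut_cell k A m"
    unfolding 1 by (rule face_of_Int_supporting_hyperplane_le)
      (auto simp: polytope_cut_cell polytope_imp_convex, simp add: cut_cell_def)
  show "(cut_cell k A m \<inter> cut_cell k (- A) (k - m)) face_of cut_cell k (- A) (k - m)"
    unfolding 2 by (rule face_of_Int_supporting_hyperplane_ge)
      (auto simp: polytope_cut_cell polytope_imp_convex, simp add: cut_cell_Compl[OF mk])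
  show "\<not> cut_cell k A m \<subseteq> cut_cell k (- A) (k - m)"
    using cut_cell_not_subset[OF assms] .
  show "\<not> cut_cell k (- A) (k - m) \<subseteq> cut_cell k A m"
    using cut_cell_not_subset[OF cut_pair_Compl[OF assms]] mk by simp
  show "cut_cell k A m \<union> cut_cell k (- A) (k - m) = hypersimplex k"
    unfolding cut_cell_Compl[OF mk] by (auto simp: cut_cell_def)
qed (auto simp: polytope_cut_cell intro: extreme_point_of_cut_cell)

subsection \<open>Hyperplanes that cut no edge\<close>

lemma sum_exchange:
  fixes a :: "'n::finite \<Rightarrow> real"
  assumes "i \<in> S" "j \<notin> S"
  shows "sum a (insert j (S - {i})) = sum a S - a i + a j"
  using assms by (simp add: sum_diff1)

lemma card_exchange:
  fixes S :: "'n::finite set"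
  assumes "i \<in> S" "j \<notin> S"
  shows "card (insert j (S - {i})) = card S"
  using assms card_Suc_Diff1[of S i] by simp

text \<open>The sets \<open>T - Z\<close> and \<open>Z - T\<close> have equal size, and the minimum
  of \<open>a\<close> on \<open>Z - T\<close> bounds \<open>a\<close> from above on
  \<open>T - Z\<close>.\<close>

lemma sum_le_if_no_increasing_exchange:
  fixes a :: "'n::finite \<Rightarrow> real"
  assumes "\<And>i j. i \<in> Z \<Longrightarrow> j \<notin> Z \<Longrightarrow> a j \<le> a i" and "card T = card Z"
  shows "sum a T \<le> sum a Z"
proof -
  have card: "card (T - Z) = card (Z - T)"
    using assms(2) by (simp add: card_Diff_subset_Int Int_commute)
  have "sum a (T - Z) \<le> sum a (Z - T)"
  proof (cases "Z - T = {}")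
    case True
    then have "T - Z = {}" using card by (metis card_eq_0_iff finite)
    with True show ?thesis by (metis order_refl)
  next
    case False
    define c where "c = Min (a ` (Z - T))"
    have "a j \<le> c" if "j \<in> T - Z" for j
      unfolding c_def using False that assms(1) by (subst Min_ge_iff) auto
    then have "sum a (T - Z) \<le> of_nat (card (T - Z)) * c"
      by (rule sum_bounded_above)
    also have "\<dots> \<le> sum a (Z - T)"
      unfolding card by (rule sum_bounded_below) (auto simp: c_def)
    finally show ?thesis .
  qed
  moreover have "sum a T = sum a (T - Z) + sum a (T \<inter> Z)" "sum a Z = sum a (Z - T) + sum a (T \<inter> Z)"
    by (metis add.commute finite sum.Int_Diff, metis Int_commute add.commute finite sum.Int_Diff)
  ultimately show ?thesis by simp
qed

text \<open>Walk from \<open>S\<close> to \<open>T\<close> by exchanges that bring the set closer to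
  \<open>T\<close>. The sum starts below \<beta>, cannot jump over \<beta>, and would end above it,
  so some set on the way has sum exactly \<beta>.\<close>

lemma exists_level_set:
  fixes a :: "'n::finite \<Rightarrow> real"
  assumes nocross: "\<And>S i j. card S = k \<Longrightarrow> i \<in> S \<Longrightarrow> j \<notin> S \<Longrightarrow> sum a S < \<beta>
      \<Longrightarrow> sum a (insert j (S - {i})) \<le> \<beta>"
    and "card S = k" "card T = k" "sum a S < \<beta>" "\<beta> < sum a T"
  shows "\<exists>Z. card Z = k \<and> sum a Z = \<beta>"
  using assms(2,4)
proof (induction "card (T - S)" arbitrary: S rule: less_induct)
  case less
  have "S \<noteq> T" using less.prems assms(5) by auto
  then obtain i j where ij: "i \<in> S" "i \<notin> T" "j \<in> T" "j \<notin> S"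
    using less.prems(1) assms(3) by (metis card_subset_eq finite subsetI)
  let ?S = "insert j (S - {i})"
  have card: "card ?S = k" using card_exchange ij less.prems by metis
  have "sum a ?S \<le> \<beta>" using nocross ij less.prems by blast
  moreover have "T - ?S \<subset> T - S" using ij by auto
  then have "card (T - ?S) < card (T - S)" by (simp add: psubset_card_mono)
  ultimately show ?case
    using less.hyps[of ?S] card by fastforce
qed

text \<open>At a level set Z, an exchange raising the sum and one lowering it can be carried out
  simultaneously, and not crossing \<open>\<beta>\<close> in either order forces the two changes to cancel.\<close>

lemma two_valued_of_no_crossing_exchange:
  fixes a :: "'n::finite \<Rightarrow> real"
  assumes nocross: "\<And>S i j. card S = k \<Longrightarrow> i \<in> S \<Longrightarrow> j \<notin> S \<Longrightarrow> sum a S < \<beta>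
      \<Longrightarrow> sum a (insert j (S - {i})) \<le> \<beta>"
    and S: "card S = k" "sum a S < \<beta>" and T: "card T = k" "\<beta> < sum a T"
  obtains A m \<alpha> \<delta> where "0 < \<delta>" "\<forall>i. a i = \<alpha> + (if i \<in> A then \<delta> else 0)"
    "\<beta> = real k * \<alpha> + \<delta> * real m"
proof -
  obtain Z where Z: "card Z = k" "sum a Z = \<beta>"
    using exists_level_set[OF nocross S(1) T(1) S(2) T(2)] by blast
  have "\<exists>i j. i \<in> Z \<and> j \<notin> Z \<and> a i < a j"
    using sum_le_if_no_increasing_exchange[of Z a T] Z T by force
  then obtain i j where up: "i \<in> Z" "j \<notin> Z" "a i < a j" by blast
  have "\<exists>i j. i \<in> Z \<and> j \<notin> Z \<and> a j < a i"
    using sum_le_if_no_increasing_exchange[of Z "\<lambda>l. - a l" S] Z S by (force simp: sum_negf)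
  then obtain i' j' where down: "i' \<in> Z" "j' \<notin> Z" "a j' < a i'" by blast
  have exch: "sum a (insert r (Z - {l})) = \<beta> - a l + a r" "card (insert r (Z - {l})) = k"
    if "l \<in> Z" "r \<notin> Z" for l r
    by (simp_all only: Z sum_exchange[OF that] card_exchange[OF that])
  \<comment> \<open>This claim and the next one ensure that a raising and a lowering exchange at
    \<open>Z\<close> use disjoint elements. If they shared an element, a single exchange would lead
    from below \<beta> to above it.\<close>
  have same_out: False if "l \<in> Z" "r \<notin> Z" "r' \<notin> Z" "a l < a r" "a r' < a l" for l r r'
  proof -
    have "r \<noteq> r'" using that by auto
    let ?N = "insert r' (Z - {l})"
    have "sum a ?N < \<beta>" "card ?N = k"
      using that exch by simp_all
    then have "sum a (insert r (?N - {r'})) \<le> \<beta>"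
      using nocross[of ?N r' r] that \<open>r \<noteq> r'\<close> by auto
    moreover have "insert r (?N - {r'}) = insert r (Z - {l})" using that by auto
    ultimately show False using that exch by simp
  qed
  have same_in: False if "l \<in> Z" "l' \<in> Z" "r \<notin> Z" "a l < a r" "a r < a l'" for l l' r
  proof -
    let ?N = "insert r (Z - {l'})"
    have in_out: "l \<in> ?N" "l' \<notin> ?N" using that by auto
    have "sum a ?N < \<beta>" "card ?N = k"
      using that exch by simp_all
    then have "sum a (insert l' (?N - {l})) \<le> \<beta>"
      using nocross[of ?N l l'] in_out by blast
    moreover have "insert l' (?N - {l}) = insert r (Z - {l})" using that by auto
    ultimately show False using that exch by simp
  qed
  have cancel: "a r - a l = a l' - a r'"
    if "l \<in> Z" "r \<notin> Z" "a l < a r" "l' \<in> Z" "r' \<notin> Z" "a r' < a l'" for l r l' r'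
  proof (rule antisym)
    have ne: "l \<noteq> l'" "r \<noteq> r'" using same_out same_in that by blast+
    \<comment> \<open>\<open>?N\<close> results from the lowering exchange, \<open>?P\<close> from
      the raising one, and \<open>?W\<close> from both.\<close>
    let ?N = "insert r' (Z - {l'})" and ?P = "insert r (Z - {l})"
    let ?W = "insert r (?N - {l})"
    have in_out: "l \<in> ?N" "r \<notin> ?N" "r' \<in> ?W" "l' \<notin> ?W"
      using that ne by auto
    have W: "sum a ?W = \<beta> - a l' + a r' - a l + a r" "card ?W = k"
      by (simp_all only: sum_exchange[OF in_out(1,2)] card_exchange[OF in_out(1,2)] exch[OF that(4,5)])
    have "sum a ?N < \<beta>" "card ?N = k"
      using that exch by simp_all
    then have "sum a ?W \<le> \<beta>"
      using nocross[of ?N l r] in_out by blast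
    then show "a r - a l \<le> a l' - a r'"
      using W by simp
    \<comment> \<open>Undoing the lowering exchange leads from \<open>?W\<close> to
      \<open>?P\<close>, which is above \<beta>, so \<open>?W\<close> is not below \<beta>.\<close>
    have "insert l' (?W - {r'}) = ?P" using that ne by auto
    moreover have "\<beta> < sum a ?P"
      using that exch by simp
    ultimately have "\<not> sum a ?W < \<beta>"
      using nocross[OF W(2) in_out(3,4)] by (metis not_le)
    then show "a l' - a r' \<le> a r - a l"
      using W by simp
  qed
  define \<delta> where "\<delta> = a j - a i"
  define A where "A = {l. a l = a i + \<delta>}"
  have "\<delta> > 0" using up by (simp add: \<delta>_def)
  have up_eq: "a r - a l = \<delta>" if "l \<in> Z" "r \<notin> Z" "a l < a r" for l r
    using cancel[OF that down] cancel[OF up down] by (simp add: \<delta>_def)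
  \<comment> \<open>Elements of \<open>Z\<close> are compared with \<open>j\<close> and the others
    with \<open>i\<close>: one inequality is impossible by \<open>same_in\<close> or
    \<open>same_out\<close>, and the opposite strict one is a raising exchange, of size
    \<delta>.\<close>
  have "a l = a i \<or> a l = a i + \<delta>" for l
  proof (cases "l \<in> Z")
    case True
    then have "a l = a j \<or> a l < a j"
      using same_in[of i l j] up by force
    then show ?thesis using up_eq[OF True up(2)] by (auto simp: \<delta>_def)
  next
    case False
    then have "a l = a i \<or> a i < a l"
      using same_out[of i j l] up by force
    then show ?thesis using up_eq[OF up(1) False] by auto
  qed
  then have a: "a l = a i + (if l \<in> A then \<delta> else 0)" for l
    by (auto simp: A_def)
  have "\<beta> = (\<Sum>l\<in>Z. a i + (if l \<in> A then \<delta> else 0))"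
    unfolding Z(2)[symmetric] by (rule sum.cong[OF refl a])
  also have "\<dots> = real k * a i + \<delta> * real (card (A \<inter> Z))"
    using Z(1) by (simp add: sum.distrib sum.If_cases Int_commute)
  finally show thesis using that \<open>\<delta> > 0\<close> a by blast
qed

section \<open>Edges of the hypersimplex and the shape of every split\<close>

lemma card_Int_less:
  fixes S T :: "'n::finite set"
  assumes "card S = k" "card T = k" "S \<noteq> T"
  shows "card (S \<inter> T) < k"
proof -
  have "S \<inter> T \<noteq> S" using assms by (metis card_subset_eq finite inf.absorb_iff1)
  then show ?thesis using assms by (metis finite inf_le1 psubsetI psubset_card_mono)
qed

text \<open>Otherwise the hyperplane meets an edge of the hypersimplex in an inner point, which is a
  vertex of the cell but not of the hypersimplex.\<close>

lemma no_crossing_exchange: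
  fixes a :: "real ^ 'n::finite"
  assumes ext: "\<And>v. v extreme_point_of (hypersimplex k \<inter> {x. a \<bullet> x \<le> \<beta>}) \<Longrightarrow> v extreme_point_of (hypersimplex k)"
    and S: "card S = k" and ij: "i \<in> S" "j \<notin> S" and less: "a \<bullet> indvec S < \<beta>"
  shows "a \<bullet> indvec (insert j (S - {i})) \<le> \<beta>"
proof (rule ccontr)
  assume neg: "\<not> ?thesis"
  define S' where "S' = insert j (S - {i})"
  define C where "C = hypersimplex k \<inter> {x. a \<bullet> x \<le> \<beta>}"
  have S': "card S' = k" and gt: "\<beta> < a \<bullet> indvec S'"
    using card_exchange[OF ij] S neg by (auto simp: S'_def)
  \<comment> \<open>This functional exposes the edge from \<open>indvec S\<close> to
    \<open>indvec S'\<close>: it equals 2k - 1 at its ends and is at most 2k - 2 at all other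
    vertices.\<close>
  define g where "g = indvec S + indvec S'"
  have g: "g \<bullet> indvec T = real (card (S \<inter> T)) + real (card (S' \<inter> T))" for T
    by (simp add: g_def inner_add_left)
  have "S \<inter> S' = S - {i}" using ij by (auto simp: S'_def)
  then have Int: "real (card (S \<inter> S')) = real k - 1"
    using S ij card_Suc_Diff1[of S i] by simp
  have gS: "g \<bullet> indvec S = 2 * real k - 1" "g \<bullet> indvec S' = 2 * real k - 1"
    using Int S S' by (simp_all add: g Int_commute)
  have gT: "g \<bullet> indvec T \<le> 2 * real k - 2" if "card T = k" "T \<noteq> S" "T \<noteq> S'" for T
    using card_Int_less[OF S that(1)] card_Int_less[OF S' that(1)] that by (force simp: g)
  have "indvec ` {T. card T = k} \<subseteq> {x. g \<bullet> x \<le> 2 * real k - 1}"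
    using gS gT by force
  then have "hypersimplex k \<subseteq> {x. g \<bullet> x \<le> 2 * real k - 1}"
    unfolding hypersimplex_eq_convex_hull by (intro hull_minimal convex_halfspace_le)
  moreover have convC: "convex C"
    unfolding C_def by (intro convex_Int convex_hypersimplex convex_halfspace_le)
  ultimately have face: "(C \<inter> {x. g \<bullet> x = 2 * real k - 1}) face_of C" (is "?F face_of C")
    by (intro face_of_Int_supporting_hyperplane_le) (auto simp: C_def)
  \<comment> \<open>Vertices of the face \<open>?F\<close> are vertices of \<open>C\<close>, hence
    of the hypersimplex. Only the ends of the edge attain 2k - 1, and \<open>indvec S'\<close> is
    cut off, so \<open>?F\<close> shrinks to a point.\<close>
  have "v = indvec S" if "v extreme_point_of ?F" for v
  proof -
    have v: "v extreme_point_of C" "v \<in> ?F"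
      using that extreme_point_of_face[OF face] by auto
    then obtain T where T: "card T = k" "v = indvec T"
      using ext by (auto simp: C_def extreme_point_of_hypersimplex)
    then have "T = S \<or> T = S'" using gT[OF T(1)] v(2) by auto
    moreover have "T \<noteq> S'" using v(2) gt T(2) by (auto simp: C_def)
    ultimately show ?thesis using T by simp
  qed
  then have "convex hull {v. v extreme_point_of ?F} \<subseteq> {indvec S}"
    by (intro hull_minimal) auto
  moreover have "compact ?F"
    unfolding C_def hypersimplex_eq_box_slice
    by (intro compact_Int_closed compact_cbox closed_hyperplane closed_halfspace_le)
  moreover have "convex ?F"
    using convC by (intro convex_Int convex_hyperplane)
  ultimately have F: "?F \<subseteq> {indvec S}"
    using Krein_Milman_Minkowski by blast
  \<comment> \<open>The parameter at which the edge crosses the hyperplane; the crossing point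
    \<open>p\<close> is a second point of \<open>?F\<close>.\<close>
  define t where "t = (\<beta> - a \<bullet> indvec S) / (a \<bullet> indvec S' - a \<bullet> indvec S)"
  define p where "p = (1 - t) *\<^sub>R indvec S + t *\<^sub>R indvec S'"
  have t: "0 \<le> t" "t \<le> 1" using less gt by (auto simp: t_def)
  have "a \<bullet> p = a \<bullet> indvec S + t * (a \<bullet> indvec S' - a \<bullet> indvec S)"
    by (simp add: p_def inner_add_right algebra_simps)
  then have ap: "a \<bullet> p = \<beta>" using less gt by (simp add: t_def)
  have "p \<in> hypersimplex k"
    unfolding p_def using convex_hypersimplex indvec_in_hypersimplex[OF S] indvec_in_hypersimplex[OF S'] t
    by (intro convexD) auto
  moreover have "g \<bullet> p = 2 * real k - 1"
    by (simp add: p_def inner_add_right gS left_diff_distrib)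
  ultimately have "p \<in> ?F" using ap by (simp add: C_def)
  then have "p = indvec S" using F by blast
  with ap less show False by simp
qed

lemma is_split_hypersimplexE:
  fixes \<Sigma> :: "(real ^ 'n::finite) set set"
  assumes "is_split (hypersimplex k) \<Sigma>"
  obtains A m where "cut_pair k A m" "\<Sigma> = cut_split k A m"
proof -
  obtain C D where CD: "polytope C" "polytope D" "(C \<inter> D) face_of C" "(C \<inter> D) face_of D"
    "\<not> C \<subseteq> D" "\<not> D \<subseteq> C" "C \<union> D = hypersimplex k"
    and ext: "\<forall>v. v extreme_point_of C \<longrightarrow> v extreme_point_of (hypersimplex k)"
    and "\<forall>v. v extreme_point_of D \<longrightarrow> v extreme_point_of (hypersimplex k)"
    and \<Sigma>: "\<Sigma> = {F. F face_of C} \<union> {F. F face_of D}"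
    by (rule is_split_obtain_cells[OF assms])
  obtain a \<beta> where C: "C = hypersimplex k \<inter> {x. a \<bullet> x \<le> \<beta>}"
    and D: "D = hypersimplex k \<inter> {x. a \<bullet> x \<ge> \<beta>}"
    by (rule two_cells_halfspaces[OF CD convex_hypersimplex])
  have a_indvec: "a \<bullet> indvec S = sum (($) a) S" for S
    by (metis inner_commute inner_indvec)
  have nocross: "sum (($) a) (insert j (S - {i})) \<le> \<beta>"
    if "card S = k" "i \<in> S" "j \<notin> S" "sum (($) a) S < \<beta>" for S i j
    using no_crossing_exchange[of k a \<beta> S i j] ext that unfolding C a_indvec by blast
  \<comment> \<open>Otherwise the whole hypersimplex lies on the side of \<open>D\<close>, and
    \<open>C\<close> would be contained in \<open>D\<close>.\<close>
  have "\<exists>S. card S = k \<and> sum (($) a) S < \<beta>"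
  proof (rule ccontr)
    assume "\<not> ?thesis"
    then have "indvec ` {S. card S = k} \<subseteq> {x. a \<bullet> x \<ge> \<beta>}"
      by (force simp: a_indvec)
    then have "hypersimplex k \<subseteq> {x. a \<bullet> x \<ge> \<beta>}"
      unfolding hypersimplex_eq_convex_hull by (intro hull_minimal convex_halfspace_ge)
    then show False using CD(5) C D by auto
  qed
  then obtain S where S: "card S = k" "sum (($) a) S < \<beta>" by blast
  have "\<exists>S. card S = k \<and> \<beta> < sum (($) a) S"
  proof (rule ccontr)
    assume "\<not> ?thesis"
    then have "indvec ` {S. card S = k} \<subseteq> {x. a \<bullet> x \<le> \<beta>}"
      by (force simp: a_indvec)
    then have "hypersimplex k \<subseteq> {x. a \<bullet> x \<le> \<beta>}"
      unfolding hypersimplex_eq_convex_hull by (intro hull_minimal convex_halfspace_le)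
    then show False using CD(6) C D by auto
  qed
  then obtain T where T: "card T = k" "\<beta> < sum (($) a) T" by blast
  obtain A m \<alpha> \<delta> where \<delta>: "0 < \<delta>" and a: "\<forall>i. a $ i = \<alpha> + (if i \<in> A then \<delta> else 0)"
    and \<beta>: "\<beta> = real k * \<alpha> + \<delta> * real m"
    by (rule two_valued_of_no_crossing_exchange[OF nocross S T])
  have "a = \<alpha> *\<^sub>R indvec UNIV + \<delta> *\<^sub>R indvec A"
    using a by (simp add: vec_eq_iff)
  then have "a \<bullet> x = \<alpha> * (indvec UNIV \<bullet> x) + \<delta> * (indvec A \<bullet> x)" for x
    by (simp add: inner_add_left)
  \<comment> \<open>On the hypersimplex the constant part of \<open>a\<close> contributes k times
    \<alpha>, so only a positive multiple of x(A) - m remains.\<close>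
  then have ax: "a \<bullet> x = \<beta> + \<delta> * (indvec A \<bullet> x - real m)" if "x \<in> hypersimplex k" for x
    using that \<beta> by (simp add: hypersimplex_eq_box_slice algebra_simps)
  have ax_le: "a \<bullet> x \<le> \<beta> \<longleftrightarrow> indvec A \<bullet> x \<le> real m"
    and ax_ge: "\<beta> \<le> a \<bullet> x \<longleftrightarrow> real m \<le> indvec A \<bullet> x" if "x \<in> hypersimplex k" for x
    using ax[OF that] \<delta> by (simp_all add: mult_le_0_iff zero_le_mult_iff)
  have "card (A \<inter> S) < m" "m < card (A \<inter> T)"
    using ax_ge[OF indvec_in_hypersimplex[OF S(1)]] ax_le[OF indvec_in_hypersimplex[OF T(1)]] S T
    by (simp_all add: a_indvec)
  then have pair: "cut_pair k A m" using S T cut_pair_iff by blast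
  then have "m \<le> k" by (simp add: cut_pair_def)
  have "C = cut_cell k A m" "D = cut_cell k (- A) (k - m)"
    unfolding C D cut_cell_Compl[OF \<open>m \<le> k\<close>] using ax_le ax_ge by (auto simp: cut_cell_def)
  then show thesis using that pair \<Sigma> unfolding cut_split_def by blast
qed

subsection \<open>Counting the splits\<close>

text \<open>Together the two cells determine which \<open>k\<close>-sets lie below, on or above the
  hyperplane. Take a \<open>k\<close>-set on it that contains \<open>u\<close> in \<open>A\<close>
  and misses \<open>v\<close> outside \<open>A\<close>. Exchanging \<open>u\<close> for
  \<open>v\<close> moves it below, and for \<open>A'\<close> this is possible only if
  \<open>u\<close> is in \<open>A'\<close> and \<open>v\<close> is not.\<close>

lemma cut_cell_inject:
  assumes pair: "cut_pair k A m" and "m' \<le> k"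
    and 1: "cut_cell k A m = cut_cell k A' m'"
    and 2: "cut_cell k (- A) (k - m) = cut_cell k (- A') (k - m')"
  shows "A = A' \<and> m = m'"
proof -
  have "m \<le> k" using pair by (simp add: cut_pair_def)
  have le: "card (A \<inter> S) \<le> m \<longleftrightarrow> card (A' \<inter> S) \<le> m'" if "card S = k" for S
    using 1 indvec_in_cut_cell[OF that] by blast
  have ge: "m \<le> card (A \<inter> S) \<longleftrightarrow> m' \<le> card (A' \<inter> S)" if "card S = k" for S
    using 2 indvec_in_cut_cell_Compl[OF that] \<open>m \<le> k\<close> \<open>m' \<le> k\<close> by blast
  have key: "u \<in> A' \<and> v \<notin> A' \<and> (\<exists>S. card S = k \<and> card (A \<inter> S) = m \<and> card (A' \<inter> S) = m')" if "u \<in> A" "v \<notin> A" for u v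
  proof -
    \<comment> \<open>Strictness of \<open>k - m < card (- A)\<close> leaves room to avoid
      \<open>v\<close>.\<close>
    have "m - 1 \<le> card (A - {u})" "k - m \<le> card (- A - {v})"
      using pair that by (auto simp: cut_pair_def)
    then obtain S1 S2 where S12: "S1 \<subseteq> A - {u}" "card S1 = m - 1" "S2 \<subseteq> - A - {v}" "card S2 = k - m"
      by (metis obtain_subset_with_card_n)
    define S where "S = insert u (S1 \<union> S2)"
    have "card (S1 \<union> S2) = card S1 + card S2"
      using S12 by (intro card_Un_disjoint) auto
    moreover have "u \<notin> S1 \<union> S2" using S12 that by auto
    ultimately have S: "card S = k"
      using S12 pair by (simp add: S_def cut_pair_def)
    have "A \<inter> S = insert u S1" using S12 that by (auto simp: S_def)
    moreover have "u \<notin> S1" using S12 by auto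
    ultimately have AS: "card (A \<inter> S) = m"
      using S12 pair by (simp add: cut_pair_def)
    then have A'S: "card (A' \<inter> S) = m'"
      using le[OF S] ge[OF S] by simp
    have uv: "u \<in> S" "v \<notin> S" using S12 that by (auto simp: S_def)
    let ?S = "insert v (S - {u})"
    have S': "card ?S = k" using card_exchange[OF uv] S by simp
    have "A \<inter> ?S = (A \<inter> S) - {u}" using that by auto
    then have "card (A \<inter> ?S) < m"
      using AS that uv pair by (simp add: card_Diff_singleton cut_pair_def)
    then have less: "card (A' \<inter> ?S) < m'"
      using ge[OF S'] by simp
    have u: "u \<in> A'"
    proof (rule ccontr)
      assume "u \<notin> A'"
      then have "A' \<inter> S \<subseteq> A' \<inter> ?S" by auto
      then have "m' \<le> card (A' \<inter> ?S)" unfolding A'S[symmetric] by (simp add: card_mono)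
      with less show False by simp
    qed
    moreover have "v \<notin> A'"
    proof
      assume "v \<in> A'"
      then have "A' \<inter> ?S = insert v ((A' \<inter> S) - {u})" by auto
      then have "card (A' \<inter> ?S) = card (A' \<inter> S)"
        using u uv card_exchange[of u "A' \<inter> S" v] by auto
      with less A'S show False by simp
    qed
    ultimately show ?thesis using S AS A'S by blast
  qed
  have "A \<noteq> {}" "- A \<noteq> {}" using pair by (auto simp: cut_pair_def)
  then obtain u v where uv: "u \<in> A" "v \<notin> A" by blast
  then have "A = A'" using key by blast
  moreover from this have "m = m'" using key[OF uv] by auto
  ultimately show ?thesis ..
qed

lemma maximal_cells_cut_split:
  assumes "cut_pair k A m"
  shows "maximal_cells (cut_split k A m) = {cut_cell k A m, cut_cell k (- A) (k - m)}"
proof -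
  have "m \<le> k" using assms by (simp add: cut_pair_def)
  then show ?thesis
    unfolding cut_split_def
    using cut_cell_not_subset[OF assms] cut_cell_not_subset[OF cut_pair_Compl[OF assms]]
    by (intro maximal_cells_faces_of_two) (auto simp: polytope_cut_cell polytope_imp_convex)
qed

text \<open>The maximal cells recover the unordered pair of cells; its two orderings give the two
  alternatives.\<close>

lemma cut_split_eq_iff:
  assumes "cut_pair k A m" "cut_pair k A' m'"
  shows "cut_split k A m = cut_split k A' m' \<longleftrightarrow> A' = A \<and> m' = m \<or> A' = - A \<and> m' = k - m"
proof
  have le: "m \<le> k" "m' \<le> k" using assms by (auto simp: cut_pair_def)
  assume "cut_split k A m = cut_split k A' m'"
  then have "{cut_cell k A m, cut_cell k (- A) (k - m)} = {cut_cell k A' m', cut_cell k (- A') (k - m')}"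
    using maximal_cells_cut_split assms by metis
  then consider
    "cut_cell k A m = cut_cell k A' m'" "cut_cell k (- A) (k - m) = cut_cell k (- A') (k - m')" |
    "cut_cell k A m = cut_cell k (- A') (k - m')" "cut_cell k (- A) (k - m) = cut_cell k (- (- A')) (k - (k - m'))"
    using le by (fastforce simp: doubleton_eq_iff)
  then show "A' = A \<and> m' = m \<or> A' = - A \<and> m' = k - m"
  proof cases
    case 1
    then show ?thesis using cut_cell_inject[OF assms(1) le(2)] by blast
  next
    case 2
    then have "A = - A' \<and> m = k - m'"
      using cut_cell_inject[OF assms(1), of "k - m'" "- A'"] by simp
    then show ?thesis using le by auto
  qed
next
  assume "A' = A \<and> m' = m \<or> A' = - A \<and> m' = k - m"
  then show "cut_split k A m = cut_split k A' m'"
    using cut_split_Compl[of m k A] assms by (auto simp: cut_pair_def)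
qed

lemma splits_hypersimplex:
  "{\<Sigma>. is_split (hypersimplex k) \<Sigma>} = case_prod (cut_split k) ` {(A :: 'n::finite set, m). cut_pair k A m}"
  by (force intro: is_split_cut_split elim: is_split_hypersimplexE)

lemma finite_cut_pairs: "finite {(A :: 'n::finite set, m). cut_pair k A m}"
  by (rule finite_subset[of _ "UNIV \<times> {..<k}"]) (auto simp: cut_pair_def)

lemma card_cut_pairs_eq:
  "card {(A :: 'n::finite set, m). cut_pair k A m}
    = 2 * card {\<Sigma> :: (real ^ 'n) set set. is_split (hypersimplex k) \<Sigma>}"
proof -
  let ?T = "{(A :: 'n set, m). cut_pair k A m}" and ?f = "case_prod (cut_split k)"
  have "card {x \<in> ?T. ?f x = y} = 2" if y_in: "y \<in> ?f ` ?T" for y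
  proof -
    obtain A m where y: "cut_pair k A m" "y = cut_split k A m"
      using y_in by auto
    have "{x \<in> ?T. ?f x = y} = {(A, m), (- A, k - m)}"
      using y cut_pair_Compl[OF y(1)] cut_split_eq_iff[OF y(1)] by auto
    \<comment> \<open>This keeps the two pairs in a fibre distinct even when m = k - m.\<close>
    moreover have "A \<noteq> - A" by auto
    ultimately show ?thesis by simp
  qed
  then have "(\<Sum>y\<in>?f ` ?T. card {x \<in> ?T. ?f x = y}) = 2 * card (?f ` ?T)"
    by simp
  moreover have "card ?T = (\<Sum>y\<in>?f ` ?T. card {x \<in> ?T. ?f x = y})"
    by (simp only: card_eq_sum) (rule sum.image_gen[OF finite_cut_pairs])
  ultimately show ?thesis unfolding splits_hypersimplex by simp
qed

section \<open>Evaluating the number of pairs by binomial sums\<close>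

lemma card_sets_card_le: "card {A :: 'n::finite set. card A \<le> m} = (\<Sum>i\<le>m. CARD('n) choose i)"
proof -
  have "{A :: 'n set. card A \<le> m} = (\<Union>i\<le>m. {A. A \<subseteq> UNIV \<and> card A = i})"
    by auto
  then have "card {A :: 'n set. card A \<le> m} = (\<Sum>i\<le>m. card {A :: 'n set. A \<subseteq> UNIV \<and> card A = i})"
    by (simp only:) (subst card_UN_disjoint, auto)
  also have "\<dots> = (\<Sum>i\<le>m. CARD('n) choose i)"
    by (intro sum.cong refl n_subsets) auto
  finally show ?thesis .
qed

text \<open>Remove the sets that are too small and those whose complement is too small. A set of
  both kinds would give n <= m + l, so nothing is subtracted twice.\<close>

lemma card_sets_between:
  assumes "m + l < CARD('n::finite)"
  shows "int (card {A :: 'n set. m < card A \<and> l < card (- A)})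
    = 2 ^ CARD('n) - (\<Sum>i\<le>m. int (CARD('n) choose i)) - (\<Sum>i\<le>l. int (CARD('n) choose i))"
proof -
  let ?M = "{A :: 'n set. m < card A \<and> l < card (- A)}"
  let ?L = "{A :: 'n set. card A \<le> m}" and ?R = "{A :: 'n set. card (- A) \<le> l}"
  have "?R = uminus ` {A :: 'n set. card A \<le> l}"
    by (auto simp: image_iff)
  then have R: "card ?R = (\<Sum>i\<le>l. CARD('n) choose i)"
    by (simp add: card_image inj_on_def card_sets_card_le)
  have "card A + card (- A) = CARD('n)" for A :: "'n set"
    by (metis card_Un_disjoint Compl_disjoint Compl_partition finite)
  then have disj: "?L \<inter> ?R = {}"
    using assms by (metis (mono_tags, lifting) add_mono disjoint_iff leD mem_Collect_eq)
  have "?M \<union> (?L \<union> ?R) = UNIV" by auto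
  then have "card (UNIV :: 'n set set) = card (?M \<union> (?L \<union> ?R))" by simp
  also have "\<dots> = card ?M + card (?L \<union> ?R)"
    by (rule card_Un_disjoint) auto
  also have "card (?L \<union> ?R) = card ?L + card ?R"
    using disj by (intro card_Un_disjoint) auto
  finally have "2 ^ CARD('n) = card ?M + ((\<Sum>i\<le>m. CARD('n) choose i) + (\<Sum>i\<le>l. CARD('n) choose i))"
    by (simp add: card_UNIV_set R card_sets_card_le)
  then have "int (2 ^ CARD('n)) = int (card ?M + ((\<Sum>i\<le>m. CARD('n) choose i) + (\<Sum>i\<le>l. CARD('n) choose i)))"
    by simp
  then show ?thesis by simp
qed

text \<open>For i >= 1 the coefficient of index i occurs in the inner sums with i <= m < k, that is
  k - i times, and the one of index 0 occurs k - 1 times. Indices 0 and 1 yield the first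
  summand.\<close>

lemma sum_partial_binomial_sums:
  assumes "1 \<le> k"
  shows "(\<Sum>m\<in>{1..<k}. \<Sum>i\<le>m. int (n choose i))
    = (int k - 1) * (int n + 1) + (\<Sum>i = 2..k - 1. (int k - int i) * int (n choose i))"
  using assms
proof (induction k rule: nat_induct_at_least)
  case base
  then show ?case by simp
next
  case (Suc k)
  have "{..k} = insert 0 (insert 1 {2..k})" using Suc by auto
  then have "(\<Sum>i\<le>k. int (n choose i)) = 1 + int n + (\<Sum>i = 2..k. int (n choose i))"
    by simp
  moreover have "(\<Sum>i = 2..k. (int (Suc k) - int i) * int (n choose i))
      = (\<Sum>i = 2..k. (int k - int i) * int (n choose i)) + (\<Sum>i = 2..k. int (n choose i))"
    by (simp add: sum.distrib[symmetric] algebra_simps)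
  \<comment> \<open>The term i = k vanishes.\<close>
  moreover have "(\<Sum>i = 2..k. (int k - int i) * int (n choose i)) = (\<Sum>i = 2..k - 1. (int k - int i) * int (n choose i))"
    by (rule sum.mono_neutral_right) auto
  ultimately show ?case
    using Suc by (simp add: algebra_simps)
qed

lemma card_cut_pairs:
  assumes "1 \<le> k" "k < CARD('n::finite)"
  shows "int (card {(A :: 'n set, m). cut_pair k A m}) =
    2 * ((int k - 1) * (2 ^ (CARD('n) - 1) - (int CARD('n) + 1))
      - (\<Sum>i = 2..k - 1. (int k - int i) * int (CARD('n) choose i)))"
proof -
  let ?n = "CARD('n)" and ?M = "\<lambda>m. {A :: 'n set. m < card A \<and> k - m < card (- A)}"
  let ?L = "\<lambda>m. \<Sum>i\<le>m. int (?n choose i)"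
  have "{(A :: 'n set, m). cut_pair k A m} = (\<lambda>(m, A). (A, m)) ` Sigma {1..<k} ?M"
    by (auto simp: cut_pair_def image_iff)
  moreover have "inj_on (\<lambda>(m, A). (A, m)) (Sigma {1..<k} ?M)"
    by (auto simp: inj_on_def)
  ultimately have "card {(A :: 'n set, m). cut_pair k A m} = (\<Sum>m\<in>{1..<k}. card (?M m))"
    by (simp add: card_image)
  then have "int (card {(A :: 'n set, m). cut_pair k A m}) = (\<Sum>m\<in>{1..<k}. int (card (?M m)))"
    by simp
  \<comment> \<open>Here m + (k - m) = k < n, as the count requires.\<close>
  also have "\<dots> = (\<Sum>m\<in>{1..<k}. 2 ^ ?n - ?L m - ?L (k - m))"
    using assms by (intro sum.cong refl card_sets_between) auto
  also have "\<dots> = (int k - 1) * 2 ^ ?n - (\<Sum>m\<in>{1..<k}. ?L m) - (\<Sum>m\<in>{1..<k}. ?L (k - m))"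
    using assms by (simp add: sum_subtractf of_nat_diff)
  \<comment> \<open>Replacing m by k - m identifies the two subtracted sums, which produces the
    overall factor 2.\<close>
  also have "(\<Sum>m\<in>{1..<k}. ?L (k - m)) = (\<Sum>m\<in>{1..<k}. ?L m)"
    by (rule sum.reindex_bij_witness[of _ "\<lambda>m. k - m" "\<lambda>m. k - m"]) auto
  also have "(2 :: int) ^ ?n = 2 * 2 ^ (?n - 1)"
    by (simp add: power_eq_if)
  finally show ?thesis
    unfolding sum_partial_binomial_sums[OF assms(1)] by (simp add: algebra_simps)
qed

theorem theorem5p3:
  fixes n k :: nat
  assumes "n = CARD('n::finite)"
    and "n \<ge> 2"
    and "1 \<le> k"
    and "real k \<le> real n / 2"
  shows "finite {\<Sigma>. is_split (hypersimplex k :: (real ^ 'n) set) \<Sigma>} \<and>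
    int (card {\<Sigma>. is_split (hypersimplex k :: (real ^ 'n) set) \<Sigma>}) =
      (int k - 1) * (2 ^ (n - 1) - (int n + 1))
      - (\<Sum>i = 2..k - 1. (int k - int i) * int (n choose i))"
proof
  show "finite {\<Sigma>. is_split (hypersimplex k :: (real ^ 'n) set) \<Sigma>}"
    unfolding splits_hypersimplex using finite_cut_pairs by (rule finite_imageI)
  have "k < CARD('n)" using assms by linarith
  then have "2 * int (card {\<Sigma>. is_split (hypersimplex k :: (real ^ 'n) set) \<Sigma>})
    = 2 * ((int k - 1) * (2 ^ (n - 1) - (int n + 1))
      - (\<Sum>i = 2..k - 1. (int k - int i) * int (n choose i)))"
    using card_cut_pairs[of k, where 'n='n] card_cut_pairs_eq[of k, where 'n='n] assms by simp
  then show "int (card {\<Sigma>. is_split (hypersimplex k :: (real ^ 'n) set) \<Sigma>}) =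
      (int k - 1) * (2 ^ (n - 1) - (int n + 1))
      - (\<Sum>i = 2..k - 1. (int k - int i) * int (n choose i))"
    by simp
qed

end
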